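(* Let $n$ be a positive integer, let $\pi$ be a partition of $n$, and let $m$ be the integer such that $m(m+1)/2 \le n < (m+1)(m+2)/2$. Let $s=(s_k)_{k\ge 1}$ be a sequence of integers satisfying $\gcd(k,s_k)=1$ for every $k \ge 1$. Then $\pi$ is a periodic point of the map $T_s$ if and only if, in the Ferrers graph of $\pi$, $$\#\text{ of checkers on } \mathrm{diag}[k] = \begin{cases} k, & k=1,2,\ldots,m, \\ n-m(m+1)/2, & k=m+1, \\ 0, & k>m+1. \end{cases}$$
   Context: A partition $\pi$ of a positive integer $n$ is a nonincreasing sequence $\pi=(\pi_1,\pi_2,\pi_3,\ldots)$ of nonnegative integers with $\sum_{i\ge 1}\pi_i=n$. The set of all partitions is denoted $\mathcal P$. Consider an infinite checkerboard with squares $(i,j)$, $i,j\ge 1$, where $(i,j)$ is the square in the $i$-th row (rows numbered from top to bottom) and the $j$-th column (columns numbered from left to right). The Ferrers graph of $\pi$ is the arrangement of checkers on this board in which square $(i,j)$ holds a checker if and only if $j\le \pi_i$. For $k\ge1$, the $k$-th diagonal is the set of $k$ squares $$\mathrm{diag}[k]=\{(1,k),(2,k-1),(3,k-2),\ldots,(k-1,2),(k,1)\}.$$ Given a sequence $s=(s_k)_{k\ge1}$ of integers, the map $T_s:\mathcal P\to\mathcal P$ is defined as follows. Start with the Ferrers graph of a partition. 1. For every $k\ge 1$, move each checker on $\mathrm{diag}[k]$ by $(s_k \bmod k)$ squares down the diagonal, cyclically: moving down by one square takes $(i,j)$ to $(i+1,j-1)$ if $j>1$, and takes $(k,1)$ to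 $(1,k)$ (looping around to the top of $\mathrm{diag}[k]$). All checkers are moved simultaneously. 2. Then, in each row, move the checkers to the left until the checkers of that row are contiguous starting from the left side of the board (i.e. a row containing $r$ checkers has them in columns $1,\ldots,r$). 3. Then, in each column, move the checkers up until the checkers of that column are contiguous starting from the top of the board (i.e. a column containing $c$ checkers has them in rows $1,\ldots,c$). The resulting arrangement is the Ferrers graph of a partition of the same integer, and this partition is $T_s$ of the original partition. A partition $\pi$ is a periodic point of $T_s$ if $T_s^N(\pi)=\pi$ for some integer $N\ge1$. *)

theory Defs
  imports Main
begin

text \<open>
  Sequences are indexed from 1, as are the rows and columns of the board. A sequence is a
  function on \<^typ>\<open>nat\<close> whose unused value at 0 is fixed to be 0, so that equality of
  functions is equality of partitions.
\<close>

definition is_partition :: "(nat \<Rightarrow> nat) \<Rightarrow> nat \<Rightarrow> bool" where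
  "is_partition p n \<longleftrightarrow>
     p 0 = 0 \<and> (\<forall>i\<ge>1. p (Suc i) \<le> p i) \<and> finite {i. p i \<noteq> 0} \<and> (\<Sum>i | p i \<noteq> 0. p i) = n"

type_synonym square = "nat \<times> nat"

definition ferrers :: "(nat \<Rightarrow> nat) \<Rightarrow> square set" where
  "ferrers p = {(i, j). 1 \<le> i \<and> 1 \<le> j \<and> j \<le> p i}"

definition diag :: "nat \<Rightarrow> square set" where
  "diag k = {(i, j). 1 \<le> i \<and> 1 \<le> j \<and> i + j = k + 1}"

text \<open>The square \<open>(i, 1)\<close> is the bottom of the \<open>i\<close>-th diagonal, hence the value \<open>(1, i)\<close>.\<close>

fun move_down :: "square \<Rightarrow> square" where
  "move_down (i, j) = (if j > 1 then (i + 1, j - 1) else (1, i))"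

definition shift :: "(nat \<Rightarrow> int) \<Rightarrow> square \<Rightarrow> square" where
  "shift s = (\<lambda>(i, j). let k = i + j - 1 in (move_down ^^ nat (s k mod int k)) (i, j))"

definition push_left :: "square set \<Rightarrow> square set" where
  "push_left A = {(i, j). 1 \<le> i \<and> 1 \<le> j \<and> j \<le> card {j'. (i, j') \<in> A}}"

definition push_up :: "square set \<Rightarrow> square set" where
  "push_up A = {(i, j). 1 \<le> i \<and> 1 \<le> j \<and> i \<le> card {i'. (i', j) \<in> A}}"

definition T_arrangement :: "(nat \<Rightarrow> int) \<Rightarrow> (nat \<Rightarrow> nat) \<Rightarrow> square set" where
  "T_arrangement s p = push_up (push_left (shift s ` ferrers p))"

text \<open>
  The map is given by the row lengths of the final arrangement. The lemmas \<open>ferrers_T\<close> and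
  \<open>is_partition_T\<close> below confirm that, for a partition, this is the partition of the same
  integer whose Ferrers graph is that arrangement.
\<close>

definition T :: "(nat \<Rightarrow> int) \<Rightarrow> (nat \<Rightarrow> nat) \<Rightarrow> (nat \<Rightarrow> nat)" where
  "T s p = (\<lambda>i. card {j. (i, j) \<in> T_arrangement s p})"

definition periodic_point :: "('a \<Rightarrow> 'a) \<Rightarrow> 'a \<Rightarrow> bool" where
  "periodic_point f x \<longleftrightarrow> (\<exists>N\<ge>1. (f ^^ N) x = x)"


definition board :: "square set" where
  "board = {(i, j). 1 \<le> i \<and> 1 \<le> j}"

lemma finite_rows:
  fixes A :: "square set"
  assumes "finite A"
  shows "finite {j. (i, j) \<in> A}" "finite {i. (i, j) \<in> A}"
proof -
  have "{j. (i, j) \<in> A} \<subseteq> snd ` A" "{i. (i, j) \<in> A} \<subseteq> fst ` A"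
    by (auto intro: rev_image_eqI)
  then show "finite {j. (i, j) \<in> A}" "finite {i. (i, j) \<in> A}"
    using assms by (meson finite_imageI finite_subset)+
qed

lemma card_eq_sum_rows:
  fixes A :: "square set"
  assumes "finite A"
  shows "card A = (\<Sum>i\<in>fst ` A. card {j. (i, j) \<in> A})"
proof -
  have eq: "A = Sigma (fst ` A) (\<lambda>i. {j. (i, j) \<in> A})" by (auto intro: rev_image_eqI)
  have "finite {j. (i, j) \<in> A}" for i
    using assms by (rule finite_rows)
  then have "card (Sigma (fst ` A) (\<lambda>i. {j. (i, j) \<in> A})) = (\<Sum>i\<in>fst ` A. card {j. (i, j) \<in> A})"
    using assms by (intro card_SigmaI) auto
  with eq show ?thesis by simp
qed

lemma push_left_Sigma:
  assumes "finite A" "A \<subseteq> board"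
  shows "push_left A = Sigma (fst ` A) (\<lambda>i. {1..card {j. (i, j) \<in> A}})"
proof -
  have "i \<in> fst ` A" if "1 \<le> j" "j \<le> card {j'. (i, j') \<in> A}" for i j :: nat
  proof -
    have "card {j'. (i, j') \<in> A} \<noteq> 0" using that by linarith
    then have "{j'. (i, j') \<in> A} \<noteq> {}" by (metis card.empty)
    then show ?thesis by (auto intro: rev_image_eqI)
  qed
  moreover have "1 \<le> i" if "i \<in> fst ` A" for i using that assms(2) by (auto simp: board_def)
  ultimately show ?thesis unfolding push_left_def by auto
qed

lemma push_left_card:
  assumes "finite A" "A \<subseteq> board"
  shows "finite (push_left A)" "card (push_left A) = card A" "push_left A \<subseteq> board"
proof -
  show "finite (push_left A)" "card (push_left A) = card A"
    unfolding push_left_Sigma[OF assms] card_eq_sum_rows[OF assms(1)] using assms(1)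
    by (auto simp: card_SigmaI)
  show "push_left A \<subseteq> board" by (auto simp: push_left_def board_def)
qed

lemma push_up_swap: "push_up A = prod.swap ` push_left (prod.swap ` A)"
proof -
  have "{j'. (i, j') \<in> prod.swap ` A} = {j'. (j', i) \<in> A}" for i
    by (auto intro: rev_image_eqI)
  then show ?thesis unfolding push_up_def push_left_def by (auto simp: image_iff)
qed

lemma push_up_card:
  assumes "finite A" "A \<subseteq> board"
  shows "finite (push_up A)" "card (push_up A) = card A" "push_up A \<subseteq> board"
proof -
  have *: "finite (prod.swap ` A)" "prod.swap ` A \<subseteq> board"
    using assms by (auto simp: board_def)
  have "card (prod.swap ` B) = card B" for B :: "square set"
    by (intro card_image inj_onI) (metis swap_swap)
  with push_left_card[OF *] show "finite (push_up A)" "card (push_up A) = card A"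
    unfolding push_up_swap by auto
  show "push_up A \<subseteq> board" by (auto simp: push_up_def board_def)
qed

lemma move_down_diag: "x \<in> diag k \<Longrightarrow> move_down x \<in> diag k"
  by (cases x) (auto simp: diag_def)

lemma move_down_inj: "inj_on move_down (diag k)"
  by (auto simp: inj_on_def diag_def split: if_splits)

lemma funpow_move_down_diag: "x \<in> diag k \<Longrightarrow> (move_down ^^ m) x \<in> diag k"
  by (induction m) (auto intro: move_down_diag simp del: move_down.simps)

lemma funpow_move_down_inj: "inj_on (move_down ^^ m) (diag k)"
proof (induction m)
  case (Suc m)
  have "(move_down ^^ m) ` diag k \<subseteq> diag k" using funpow_move_down_diag by blast
  then show ?case
    using comp_inj_on[OF Suc inj_on_subset[OF move_down_inj]] by (simp add: o_def)
qed auto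

lemma board_diag: "x \<in> board \<Longrightarrow> \<exists>k. x \<in> diag k"
  by (cases x) (auto simp: board_def diag_def intro: exI[of _ "fst x + snd x - 1"])

lemma diag_unique: "x \<in> diag k \<Longrightarrow> x \<in> diag l \<Longrightarrow> k = l"
  by (auto simp: diag_def)

lemma shift_diag:
  assumes "x \<in> diag k"
  shows "shift s x = (move_down ^^ nat (s k mod int k)) x"
proof (cases x)
  case (Pair i j)
  with assms have "i + j - 1 = k" by (simp add: diag_def)
  with Pair show ?thesis by (simp add: shift_def Let_def)
qed

lemma shift_in_diag: "x \<in> diag k \<Longrightarrow> shift s x \<in> diag k"
  by (simp add: shift_diag funpow_move_down_diag)

lemma shift_inj: "inj_on (shift s) board"
proof (rule inj_onI)
  fix x y assume "x \<in> board" "y \<in> board" and eq: "shift s x = shift s y"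
  then obtain k l where kl: "x \<in> diag k" "y \<in> diag l" by (meson board_diag)
  have "shift s x \<in> diag k" "shift s x \<in> diag l"
    using shift_in_diag[OF kl(1), of s] shift_in_diag[OF kl(2), of s] eq by simp_all
  then have "k = l" by (rule diag_unique)
  with eq kl have "(move_down ^^ nat (s k mod int k)) x = (move_down ^^ nat (s k mod int k)) y"
    using shift_diag[OF kl(1), of s] shift_diag[OF kl(2), of s] by simp
  with kl \<open>k = l\<close> show "x = y" by (auto intro: inj_onD[OF funpow_move_down_inj])
qed

lemma shift_board: "x \<in> board \<Longrightarrow> shift s x \<in> board"
proof -
  assume "x \<in> board"
  then obtain k where "shift s x \<in> diag k" using board_diag shift_in_diag by blast
  then show ?thesis by (auto simp: diag_def board_def)
qed

lemma ferrers_Sigma: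
  assumes "is_partition p n"
  shows "ferrers p = Sigma {i. p i \<noteq> 0} (\<lambda>i. {1..p i})"
proof -
  have "p 0 = 0" using assms by (simp add: is_partition_def)
  then have "i \<noteq> 0" if "p i \<noteq> 0" for i
    using that by (cases i) auto
  then show ?thesis
    by (auto simp: ferrers_def Suc_le_eq)
qed

lemma ferrers_card:
  assumes "is_partition p n"
  shows "finite (ferrers p)" "card (ferrers p) = n" "ferrers p \<subseteq> board"
proof -
  show "finite (ferrers p)" "card (ferrers p) = n"
    unfolding ferrers_Sigma[OF assms] using assms
    by (auto simp: is_partition_def card_SigmaI)
  show "ferrers p \<subseteq> board" by (auto simp: ferrers_def board_def)
qed

lemma T_arrangement_card:
  assumes "is_partition p n"
  shows "finite (T_arrangement s p)" "card (T_arrangement s p) = n" "T_arrangement s p \<subseteq> board"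
proof -
  let ?A = "shift s ` ferrers p"
  note F = ferrers_card[OF assms]
  have A: "finite ?A" "?A \<subseteq> board" "card ?A = n"
    using F shift_board inj_on_subset[OF shift_inj] by (auto simp: card_image)
  note L = push_left_card[OF A(1,2)]
  show "finite (T_arrangement s p)" "card (T_arrangement s p) = n" "T_arrangement s p \<subseteq> board"
    using push_up_card[OF L(1,3)] L(2) A(3) by (simp_all add: T_arrangement_def)
qed

lemma T_arrangement_down_closed:
  assumes "is_partition p n" and "(i, j) \<in> T_arrangement s p"
    and "1 \<le> i'" "i' \<le> i" "1 \<le> j'" "j' \<le> j"
  shows "(i', j') \<in> T_arrangement s p"
proof -
  let ?A = "shift s ` ferrers p"
  have "finite ?A" "?A \<subseteq> board"
    using ferrers_card[OF assms(1)] shift_board by auto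
  then have "finite (push_left ?A)" by (rule push_left_card)
  then have "card {i'. (i', j) \<in> push_left ?A} \<le> card {i. (i, j') \<in> push_left ?A}"
    using assms by (intro card_mono finite_rows) (auto simp: push_left_def)
  then show ?thesis using assms unfolding T_arrangement_def push_up_def by auto
qed

lemma ferrers_T:
  assumes "is_partition p n"
  shows "ferrers (T s p) = T_arrangement s p"
proof -
  let ?C = "T_arrangement s p"
  note C = T_arrangement_card[OF assms, of s]
  have iff: "(i, j) \<in> ?C \<longleftrightarrow> 1 \<le> i \<and> 1 \<le> j \<and> j \<le> card {j. (i, j) \<in> ?C}" for i j
  proof
    assume ij: "(i, j) \<in> ?C"
    then have "1 \<le> i" "1 \<le> j" using C(3) by (auto simp: board_def)
    moreover have "{1..j} \<subseteq> {j. (i, j) \<in> ?C}"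
      using T_arrangement_down_closed[OF assms ij] \<open>1 \<le> i\<close> by auto
    then have "card {1..j} \<le> card {j. (i, j) \<in> ?C}"
      by (rule card_mono[OF finite_rows(1)[OF C(1)]])
    ultimately show "1 \<le> i \<and> 1 \<le> j \<and> j \<le> card {j. (i, j) \<in> ?C}" by simp
  next
    assume *: "1 \<le> i \<and> 1 \<le> j \<and> j \<le> card {j. (i, j) \<in> ?C}"
    show "(i, j) \<in> ?C"
    proof (rule ccontr)
      assume "(i, j) \<notin> ?C"
      have "j' < j" if "(i, j') \<in> ?C" for j'
        using T_arrangement_down_closed[OF assms that, of i j] * \<open>(i, j) \<notin> ?C\<close> by (cases "j' < j") auto
      then have "{j. (i, j) \<in> ?C} \<subseteq> {1..<j}"
        using C(3) by (auto simp: board_def)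
      then have "card {j. (i, j) \<in> ?C} \<le> card {1..<j}" by (rule card_mono[rotated]) simp
      moreover have "card {1..<j} < j" using * by auto
      ultimately show False using * by linarith
    qed
  qed
  show ?thesis unfolding ferrers_def T_def using iff by blast
qed

lemma is_partition_T:
  assumes "is_partition p n"
  shows "is_partition (T s p) n"
proof -
  let ?C = "T_arrangement s p"
  note C = T_arrangement_card[OF assms, of s]
  have row0: "T s p i \<noteq> 0 \<longleftrightarrow> i \<in> fst ` ?C" for i
    unfolding T_def using finite_rows(1)[OF C(1), of i] by (auto intro: rev_image_eqI)
  have "T s p 0 = 0" using row0[of 0] C(3) by (auto simp: board_def)
  moreover have "T s p (Suc i) \<le> T s p i" if "1 \<le> i" for i
    unfolding T_def
  proof (intro card_mono finite_rows C(1) subsetI)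
    fix j assume "j \<in> {j. (Suc i, j) \<in> ?C}"
    then have ij: "(Suc i, j) \<in> ?C" by simp
    then have "1 \<le> j" using C(3) by (auto simp: board_def)
    with T_arrangement_down_closed[OF assms ij, of i j] that show "j \<in> {j. (i, j) \<in> ?C}" by simp
  qed
  moreover have "finite {i. T s p i \<noteq> 0}" using row0 C(1) by simp
  moreover have "(\<Sum>i | T s p i \<noteq> 0. T s p i) = n"
    using card_eq_sum_rows[OF C(1)] C(2) row0 by (simp add: T_def)
  ultimately show ?thesis unfolding is_partition_def by blast
qed

end

theory Submission
  imports Defs "HOL-Number_Theory.Cong"
begin

text \<open>
  Give the checker on \<open>(i, j)\<close> the weight \<open>i + j\<close>. The rotation of the diagonals preserves the
  total weight, and each of the two pushes strictly decreases it unless it moves nothing. So on a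
  periodic orbit the pushes are trivial and \<open>T\<close> acts as the rotation alone. If some diagonal
  \<open>k\<close> had a hole and diagonal \<open>k + 1\<close> a checker, then, as \<open>k\<close> and \<open>k + 1\<close> are coprime and both
  rotations have full order, the Chinese remainder theorem gives a time at which the hole is on
  \<open>(1, k)\<close> and the checker on \<open>(1, k + 1)\<close>, which is impossible in a Ferrers graph. Conversely,
  a full triangle together with any part of the next diagonal is a Ferrers graph, so that \<open>T\<close>
  again acts as the rotation, which has finite order there.
\<close>

section \<open>Weight of an arrangement and the effect of shift and pushes\<close>

definition weight :: "square set \<Rightarrow> nat" where
  "weight A = (\<Sum>(i, j)\<in>A. i + j)"

text \<open>Exchange argument: \<open>S\<close> has as many elements outside
  \<open>{1..card S}\<close> as that segment has gaps, and each such element exceeds every gap by at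
  least one. The extra cardinality on the left counts this surplus and settles the case of
  equality.\<close>

lemma sum_ge_initial_segment:
  fixes S :: "nat set"
  assumes "finite S" "0 \<notin> S"
  shows "\<Sum>{1..card S} + card (S - {1..card S}) \<le> \<Sum>S"
proof -
  let ?c = "card S" and ?I = "{1..card S}"
  have cards: "card (S - ?I) = card (?I - S)"
    using assms by (intro antisym card_le_sym_Diff) auto
  have I: "\<Sum>(?I - S) \<le> card (?I - S) * ?c"
    using sum_bounded_above[of "?I - S" "\<lambda>j. j" ?c] by simp
  \<comment> \<open>Since \<open>0\<close> is not in \<open>S\<close>, an element outside the
    segment is at least \<open>?c + 1\<close>.\<close>
  have S: "card (S - ?I) * (?c + 1) \<le> \<Sum>(S - ?I)"
    using sum_bounded_below[of "S - ?I" "?c + 1" "\<lambda>j. j"] assms(2) by (force simp: Suc_le_eq)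
  have "\<Sum>S = \<Sum>(S \<inter> ?I) + \<Sum>(S - ?I)" "\<Sum>?I = \<Sum>(S \<inter> ?I) + \<Sum>(?I - S)"
    using sum.Int_Diff[OF assms(1), of "\<lambda>j. j" ?I] sum.Int_Diff[of ?I "\<lambda>j. j" S]
    by (simp_all add: Int_commute)
  then show ?thesis using I S unfolding cards by simp
qed

lemma eq_initial_segmentI:
  fixes S :: "nat set"
  assumes "finite S" "card (S - {1..card S}) = 0"
  shows "S = {1..card S}"
  using assms by (intro card_subset_eq) auto

lemma weight_Sigma:
  assumes "finite I" "\<And>i. i \<in> I \<Longrightarrow> finite (R i)"
  shows "weight (Sigma I R) = (\<Sum>i\<in>I. card (R i) * i + \<Sum>(R i))"
  using assms by (simp add: weight_def sum.Sigma[symmetric] sum.distrib)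

lemma Sigma_rows: "A = Sigma (fst ` A) (\<lambda>i. {j. (i, j) \<in> A})"
  by (auto intro: rev_image_eqI)

lemma weight_push_left:
  assumes "finite A" "A \<subseteq> board"
  shows "weight (push_left A) \<le> weight A"
    and "weight (push_left A) = weight A \<Longrightarrow> push_left A = A"
proof -
  let ?R = "\<lambda>i. {j. (i, j) \<in> A}" and ?I = "fst ` A"
  let ?f = "\<lambda>i. card (?R i) * i + \<Sum>{1..card (?R i)}"
  let ?g = "\<lambda>i. card (?R i) * i + \<Sum>(?R i)"
  have R: "finite (?R i)" "0 \<notin> ?R i" for i
    using assms by (auto simp: board_def intro: finite_rows)
  have A: "weight A = sum ?g ?I"
    using weight_Sigma[of ?I ?R] R(1) assms(1) Sigma_rows[of A] by simp
  have L: "weight (push_left A) = sum ?f ?I"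
    unfolding push_left_Sigma[OF assms] using assms(1) by (subst weight_Sigma) auto
  have le: "?f i \<le> ?g i" for i
    using sum_ge_initial_segment[OF R, of i] by simp
  show "weight (push_left A) \<le> weight A"
    unfolding A L by (intro sum_mono le)
  assume "weight (push_left A) = weight A"
  then have eq: "sum ?g ?I = sum ?f ?I" by (simp only: A L)
  have "{1..card (?R i)} = ?R i" if "i \<in> ?I" for i
  proof -
    \<comment> \<open>Equal sums of termwise ordered summands agree term by term, so the surplus in
      each row vanishes.\<close>
    have "?g i = ?f i"
      using sum_mono_inv[OF eq[symmetric] le that] assms(1) by simp
    then have "card (?R i - {1..card (?R i)}) = 0"
      using sum_ge_initial_segment[OF R, of i] by simp
    then show ?thesis using eq_initial_segmentI[OF R(1), of i] by simp
  qed
  then have "push_left A = Sigma ?I ?R"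
    unfolding push_left_Sigma[OF assms] by (intro Sigma_cong refl)
  then show "push_left A = A" using Sigma_rows[of A] by simp
qed

lemma weight_swap: "weight (prod.swap ` A) = weight A"
  unfolding weight_def by (subst sum.reindex) (auto simp: add.commute intro!: sum.cong)

text \<open>The weight is symmetric in rows and columns, so transposition reduces this to
  \<open>weight_push_left\<close>.\<close>

lemma weight_push_up:
  assumes "finite A" "A \<subseteq> board"
  shows "weight (push_up A) \<le> weight A"
    and "weight (push_up A) = weight A \<Longrightarrow> push_up A = A"
proof -
  have *: "finite (prod.swap ` A)" "prod.swap ` A \<subseteq> board"
    using assms by (auto simp: board_def)
  show "weight (push_up A) \<le> weight A"
    using weight_push_left(1)[OF *] by (simp add: push_up_swap weight_swap)
  assume "weight (push_up A) = weight A"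
  then have "push_left (prod.swap ` A) = prod.swap ` A"
    using weight_push_left(2)[OF *] by (simp add: push_up_swap weight_swap)
  then show "push_up A = A" by (simp add: push_up_swap image_image)
qed

text \<open>The sum \<open>i + j\<close> is constant on a diagonal, and injectivity of the shift
  ensures that no two checkers merge.\<close>

lemma weight_shift:
  assumes "A \<subseteq> board"
  shows "weight (shift s ` A) = weight A"
proof -
  have "case_prod (+) (shift s x) = case_prod (+) x" if "x \<in> A" for x
  proof -
    have "x \<in> board" using that assms by blast
    then obtain k where "x \<in> diag k" using board_diag by blast
    with shift_in_diag[OF this, of s] show ?thesis by (auto simp: diag_def)
  qed
  moreover have "inj_on (shift s) A" using shift_inj assms by (rule inj_on_subset)
  ultimately show ?thesis by (simp add: weight_def sum.reindex)
qed

lemma weight_T: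
  assumes "is_partition p n"
  shows "weight (ferrers (T s p)) \<le> weight (ferrers p)"
    and "weight (ferrers (T s p)) = weight (ferrers p) \<Longrightarrow> ferrers (T s p) = shift s ` ferrers p"
proof -
  let ?A = "shift s ` ferrers p"
  have A: "finite ?A" "?A \<subseteq> board" and w: "weight ?A = weight (ferrers p)"
    using ferrers_card[OF assms] shift_board weight_shift by auto
  note L = push_left_card[OF A]
  have le: "weight (push_up (push_left ?A)) \<le> weight (push_left ?A)"
    "weight (push_left ?A) \<le> weight ?A"
    using weight_push_up(1)[OF L(1,3)] weight_push_left(1)[OF A] by auto
  show "weight (ferrers (T s p)) \<le> weight (ferrers p)"
    using le w by (simp add: ferrers_T[OF assms] T_arrangement_def)
  assume "weight (ferrers (T s p)) = weight (ferrers p)"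
  then have "weight (push_up (push_left ?A)) = weight (push_left ?A)"
    "weight (push_left ?A) = weight ?A"
    using le w by (simp_all add: ferrers_T[OF assms] T_arrangement_def)
  then show "ferrers (T s p) = ?A"
    using weight_push_up(2)[OF L(1,3)] weight_push_left(2)[OF A]
    by (simp add: ferrers_T[OF assms] T_arrangement_def)
qed

section \<open>Periodic orbits evolve by rotation alone\<close>

lemma is_partition_funpow_T: "is_partition p n \<Longrightarrow> is_partition ((T s ^^ t) p) n"
  by (induction t) (auto intro: is_partition_T)

text \<open>The weight never increases along an orbit, and here it returns to its initial value. It
  is therefore constant, and the equality case of \<open>weight_T\<close> applies at every
  step.\<close>

lemma ferrers_funpow_T_periodic:
  assumes p: "is_partition p n" and "periodic_point (T s) p"
  shows "ferrers ((T s ^^ t) p) = (shift s ^^ t) ` ferrers p"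
proof -
  define w where "w t = weight (ferrers ((T s ^^ t) p))" for t
  obtain N where N: "N \<ge> 1" "(T s ^^ N) p = p"
    using assms(2) by (auto simp: periodic_point_def)
  have "w (Suc t) \<le> w t" for t
    using weight_T(1)[OF is_partition_funpow_T[OF p]] by (simp add: w_def)
  then have anti: "w t \<le> w u" if "u \<le> t" for t u
    using that by (rule lift_Suc_antimono_le)
  have per: "(T s ^^ (N * q)) p = p" for q
    by (induction q) (simp_all add: N(2) funpow_add)
  have "w (Suc t) = w t" for t
  proof (rule antisym)
    \<comment> \<open>At time \<open>N * Suc t\<close>, a multiple of the period not before
      \<open>Suc t\<close>, the weight is again \<open>w 0\<close>.\<close>
    have "w t \<le> w 0" by (simp add: anti)
    also have "\<dots> = w (N * Suc t)" by (simp only: w_def per funpow_0)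
    also have "\<dots> \<le> w (Suc t)" using mult_le_mono1[OF N(1), of "Suc t"] by (intro anti) simp
    finally show "w t \<le> w (Suc t)" .
  qed (simp add: anti)
  then have step: "ferrers ((T s ^^ Suc t) p) = shift s ` ferrers ((T s ^^ t) p)" for t
    using weight_T(2)[OF is_partition_funpow_T[OF p], of s t] by (simp add: w_def)
  show ?thesis
  proof (induction t)
    case (Suc t)
    then show ?case unfolding step by (simp add: image_image)
  qed simp
qed

section \<open>Rotation of a diagonal as addition modulo its length\<close>

text \<open>The \<open>k\<close> squares of diagonal \<open>k\<close>, numbered from the top by \<open>r = 0, \<dots>, k - 1\<close>.\<close>

definition cell :: "nat \<Rightarrow> nat \<Rightarrow> square" where
  "cell k r = (r + 1, k - r)"

lemma diag_eq_cell: "diag k = cell k ` {..<k}"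
proof -
  have "(i, j) \<in> cell k ` {..<k}" if "(i, j) \<in> diag k" for i j
    using that by (intro image_eqI[of _ _ "i - 1"]) (auto simp: diag_def cell_def)
  then show ?thesis by (auto simp: cell_def diag_def)
qed

lemma finite_diag: "finite (diag k)" and card_diag: "card (diag k) = k"
proof -
  show "finite (diag k)" by (simp add: diag_eq_cell)
  have "inj_on (cell k) {..<k}" by (auto simp: cell_def inj_on_def)
  then show "card (diag k) = k" by (simp add: diag_eq_cell card_image)
qed

lemma move_down_cell:
  assumes "r < k"
  shows "move_down (cell k r) = cell k ((r + 1) mod k)"
proof (cases "r + 1 = k")
  case False
  with assms have "(r + 1) mod k = r + 1" by simp
  with assms False show ?thesis by (simp add: cell_def)
qed (auto simp: cell_def)

lemma funpow_move_down_cell: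
  assumes "r < k"
  shows "(move_down ^^ t) (cell k r) = cell k ((r + t) mod k)"
proof (induction t)
  case (Suc t)
  have "(r + t) mod k < k" using assms by simp
  then show ?case using Suc by (simp add: move_down_cell mod_Suc_eq del: move_down.simps)
qed (use assms in simp)

lemma funpow_shift_cell:
  assumes "r < k"
  shows "(shift s ^^ t) (cell k r) = cell k ((r + t * nat (s k mod int k)) mod k)"
proof (induction t)
  case (Suc t)
  let ?a = "nat (s k mod int k)"
  have lt: "(r + t * ?a) mod k < k" using assms by simp
  then have "cell k ((r + t * ?a) mod k) \<in> diag k" by (auto simp: diag_eq_cell)
  then have "(shift s ^^ Suc t) (cell k r) = cell k (((r + t * ?a) mod k + ?a) mod k)"
    using Suc lt by (simp add: shift_diag funpow_move_down_cell)
  then show ?case unfolding mod_add_left_eq by (simp add: ac_simps)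
qed (use assms in simp)

text \<open>Carries the integer gcd hypothesis over to the natural number of squares by which
  \<open>shift\<close> rotates.\<close>

lemma coprime_nat_mod:
  assumes "k \<ge> 1" "gcd (int k) (a :: int) = 1"
  shows "coprime (nat (a mod int k)) k"
proof -
  have "coprime (a mod int k) (int k)"
    using assms by (simp add: coprime_iff_gcd_eq_1 gcd.commute)
  moreover have "a mod int k = int (nat (a mod int k))" using assms(1) by simp
  ultimately show ?thesis by (metis coprime_int_iff)
qed

text \<open>Stated for a whole residue class of times, so that the classes for two diagonals of
  coprime lengths can be intersected.\<close>

lemma ex_time_to_top:
  assumes "coprime a k" "k \<ge> 1"
  shows "\<exists>t. \<forall>u. [u = t] (mod k) \<longrightarrow> (r + u * a) mod k = (0 :: nat)"
proof -
  obtain y where y: "[a * y = 1] (mod k)" using cong_solve_coprime_nat[OF assms(1)] by auto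
  \<comment> \<open>With \<open>y\<close> inverse to \<open>a\<close>, the time has to be
    \<open>y\<close> times minus \<open>r\<close>; the natural number \<open>r * (k - 1)\<close>
    represents minus \<open>r\<close> modulo \<open>k\<close>.\<close>
  have "(r + u * a) mod k = 0" if "[u = y * (r * (k - 1))] (mod k)" for u
  proof -
    have "[r + u * a = r + (a * y) * (r * (k - 1))] (mod k)"
      using cong_add[OF cong_refl cong_mult[OF that cong_refl]] by (simp add: ac_simps)
    also have "[r + (a * y) * (r * (k - 1)) = r + 1 * (r * (k - 1))] (mod k)"
      by (intro cong_add cong_mult cong_refl y)
    also have "r + 1 * (r * (k - 1)) = r * k"
      using assms(2) by (cases k) auto
    finally show ?thesis by (simp add: cong_def)
  qed
  then show ?thesis by blast
qed

lemma funpow_shift_inj: "inj_on (shift s ^^ t) board"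
proof (induction t)
  case (Suc t)
  have "(shift s ^^ t) x \<in> board" if "x \<in> board" for x
    using that by (induction t) (auto intro: shift_board)
  then have "(shift s ^^ t) ` board \<subseteq> board" by blast
  then show ?case
    using comp_inj_on[OF Suc inj_on_subset[OF shift_inj]] by (simp add: o_def)
qed simp

section \<open>A hole and a checker on consecutive diagonals\<close>

lemma periodic_diag_full_or_next_empty:
  assumes p: "is_partition p n" and per: "periodic_point (T s) p"
    and s: "\<forall>k\<ge>1. gcd (int k) (s k) = 1" and k: "k \<ge> 1"
  shows "diag k \<subseteq> ferrers p \<or> ferrers p \<inter> diag (k + 1) = {}"
proof (rule ccontr)
  assume "\<not> ?thesis"
  then obtain r q where r: "r < k" "cell k r \<notin> ferrers p"
    and q: "q < k + 1" "cell (k + 1) q \<in> ferrers p"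
    unfolding diag_eq_cell by blast
  define a b where "a = nat (s k mod int k)" and "b = nat (s (k + 1) mod int (k + 1))"
  have "coprime a k" "coprime b (k + 1)"
    unfolding a_def b_def using s k by (auto intro!: coprime_nat_mod simp del: of_nat_Suc of_nat_add)
  then obtain t\<^sub>1 t\<^sub>2 where t\<^sub>1: "\<And>u. [u = t\<^sub>1] (mod k) \<Longrightarrow> (r + u * a) mod k = 0"
    and t\<^sub>2: "\<And>u. [u = t\<^sub>2] (mod (k + 1)) \<Longrightarrow> (q + u * b) mod (k + 1) = 0"
    using ex_time_to_top[of a k r] ex_time_to_top[of b "k + 1" q] k by (metis le_add2)
  have "coprime k (k + 1)" by simp
  then obtain u where "[u = t\<^sub>1] (mod k)" "[u = t\<^sub>2] (mod (k + 1))"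
    using binary_chinese_remainder_nat by blast
  then have top: "(shift s ^^ u) (cell k r) = (1, k)"
    "(shift s ^^ u) (cell (k + 1) q) = (1, k + 1)"
    unfolding funpow_shift_cell[OF r(1)] funpow_shift_cell[OF q(1)] a_def[symmetric] b_def[symmetric]
    using t\<^sub>1 t\<^sub>2 by (simp_all add: cell_def)
  let ?F = "ferrers ((T s ^^ u) p)"
  have F: "?F = (shift s ^^ u) ` ferrers p" by (rule ferrers_funpow_T_periodic[OF p per])
  have "(1, k + 1) \<in> ?F" unfolding F top(2)[symmetric] using q(2) by (rule imageI)
  \<comment> \<open>Rows of a Ferrers graph have no gaps, so some checker has been rotated to
    \<open>(1, k)\<close>. By injectivity it started on the hole \<open>cell k r\<close>.\<close>
  then have "(1, k) \<in> ?F" using k by (simp add: ferrers_def)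
  then obtain x where x: "x \<in> ferrers p" "(shift s ^^ u) x = (shift s ^^ u) (cell k r)"
    unfolding F top(1) by auto
  have "x = cell k r"
    using inj_onD[OF funpow_shift_inj x(2)] x(1) ferrers_card(3)[OF p] r(1)
    by (auto simp: board_def cell_def)
  with x(1) r(2) show False by simp
qed

section \<open>Counting checkers by diagonals\<close>

lemma card_eq_sum_diag:
  assumes "finite A" "A \<subseteq> (\<Union>k\<in>K. diag k)" "finite K"
  shows "card A = (\<Sum>k\<in>K. card (A \<inter> diag k))"
proof -
  have "card (\<Union>k\<in>K. A \<inter> diag k) = (\<Sum>k\<in>K. card (A \<inter> diag k))"
    using assms finite_diag diag_unique by (intro card_UN_disjoint) blast+
  moreover have "(\<Union>k\<in>K. A \<inter> diag k) = A" using assms(2) by blast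
  ultimately show ?thesis by simp
qed

lemma board_subset_diag:
  assumes A: "A \<subseteq> board" "\<And>k. k \<ge> 1 \<Longrightarrow> k \<notin> K \<Longrightarrow> A \<inter> diag k = {}"
  shows "A \<subseteq> (\<Union>k\<in>K. diag k)"
proof
  fix x assume "x \<in> A"
  with A(1) obtain k where k: "x \<in> diag k" using board_diag by blast
  then have "k \<ge> 1" by (auto simp: diag_def)
  then show "x \<in> (\<Union>k\<in>K. diag k)" using A(2) k \<open>x \<in> A\<close> by blast
qed

lemma triangle_sum: "\<Sum>{1..m} = m * (m + 1) div (2 :: nat)"
  using gauss_sum_from_Suc_0[of m, where 'a = nat] by simp

text \<open>By \<open>alt\<close>, everything beyond an incomplete diagonal is empty. So
  \<open>A\<close> consists of full diagonals followed by at most one partial one, and the bounds on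
  \<open>n\<close> locate it.\<close>

lemma diag_cards_if_full_or_next_empty:
  assumes A: "finite A" "A \<subseteq> board" "card A = n"
    and alt: "\<And>k. k \<ge> 1 \<Longrightarrow> diag k \<subseteq> A \<or> A \<inter> diag (k + 1) = {}"
    and m: "m * (m + 1) div 2 \<le> n" "n < (m + 1) * (m + 2) div 2" and k: "k \<ge> 1"
  shows "card (A \<inter> diag k) = (if k \<le> m then k else if k = m + 1 then n - m * (m + 1) div 2 else 0)"
proof -
  have empty: "A \<inter> diag l = {}" if "k < l" "k \<ge> 1" "\<not> diag k \<subseteq> A" for k l
    using that
  proof (induction l)
    case (Suc l)
    show ?case
    proof (cases "k = l")
      case False
      then have "A \<inter> diag l = {}" "l \<ge> 1" using Suc by auto
      \<comment> \<open>The top square shows that \<open>diag l\<close> is nonempty; being empty of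
        checkers it is not full, so \<open>alt\<close> clears the next diagonal as well.\<close>
      moreover have "cell l 0 \<in> diag l" using \<open>l \<ge> 1\<close> by (auto simp: diag_eq_cell)
      ultimately have "\<not> diag l \<subseteq> A" by blast
      then show ?thesis using alt[OF \<open>l \<ge> 1\<close>] by simp
    qed (use Suc alt in auto)
  qed simp
  have le: "card (A \<inter> diag l) \<le> l" for l
    using card_mono[OF finite_diag, of "A \<inter> diag l" l] by (simp add: card_diag)
  have full: "diag k \<subseteq> A" if "k \<ge> 1" "k \<le> m" for k
  proof (rule ccontr)
    assume not: "\<not> diag k \<subseteq> A"
    then have "A \<inter> diag k \<subset> diag k" by blast
    then have lt: "card (A \<inter> diag k) < k"
      using psubset_card_mono[OF finite_diag, of "A \<inter> diag k" k] by (simp add: card_diag)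
    \<comment> \<open>All checkers lie on the first \<open>m\<close> diagonals, one of which is
      incomplete: too few for \<open>n\<close>.\<close>
    have "A \<subseteq> (\<Union>l\<in>{1..m}. diag l)"
      using that by (intro board_subset_diag A(2) empty[OF _ \<open>k \<ge> 1\<close> not]) auto
    then have "n = (\<Sum>l\<in>{1..m}. card (A \<inter> diag l))"
      using card_eq_sum_diag A by blast
    also have "\<dots> < \<Sum>{1..m}"
      using le lt that by (intro sum_strict_mono_ex1) auto
    finally show False using m(1) by (simp only: triangle_sum)
  qed
  have none: "A \<inter> diag k = {}" if "k > m + 1" for k
  proof (rule ccontr)
    assume "A \<inter> diag k \<noteq> {}"
    \<comment> \<open>A checker beyond \<open>m + 1\<close> forces the first \<open>m + 1\<close>
      diagonals to be full: too many for \<open>n\<close>.\<close>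
    then have *: "diag l \<subseteq> A" if "l \<in> {1..m + 1}" for l
      using empty[of l k] \<open>k > m + 1\<close> that by auto
    let ?U = "\<Union>l\<in>{1..m + 1}. diag l"
    have "?U \<inter> diag l = diag l" if "l \<in> {1..m + 1}" for l
      using that by blast
    then have "(\<Sum>l\<in>{1..m + 1}. card (?U \<inter> diag l)) = \<Sum>{1..m + 1}"
      by (intro sum.cong) (simp_all only: card_diag)
    then have "(m + 1) * (m + 2) div 2 = (\<Sum>l\<in>{1..m + 1}. card (?U \<inter> diag l))"
      using triangle_sum[of "m + 1"] by simp
    also have "\<dots> = card ?U"
      using finite_diag by (intro card_eq_sum_diag[symmetric]) auto
    also have "\<dots> \<le> n" unfolding A(3)[symmetric] using * by (intro card_mono A(1)) blast
    finally show False using m(2) by simp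
  qed
  have full_card: "card (A \<inter> diag l) = l" if "l \<in> {1..m}" for l
    using full that by (metis atLeastAtMost_iff card_diag inf.absorb2)
  have "A \<subseteq> (\<Union>l\<in>{1..m + 1}. diag l)"
    using none by (intro board_subset_diag A(2)) auto
  then have "n = (\<Sum>l\<in>{1..m + 1}. card (A \<inter> diag l))"
    using card_eq_sum_diag A by blast
  also have "\<dots> = m * (m + 1) div 2 + card (A \<inter> diag (m + 1))"
    using full_card triangle_sum[of m] by simp
  finally show ?thesis
    using full_card none k by auto
qed

section \<open>Converse: staircases are rotated without any push\<close>

lemma push_left_eq_self:
  assumes "finite A" "A \<subseteq> board"
    and lower: "\<And>i j j'. (i, j) \<in> A \<Longrightarrow> 1 \<le> j' \<Longrightarrow> j' \<le> j \<Longrightarrow> (i, j') \<in> A"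
  shows "push_left A = A"
proof -
  have "{j. (i, j) \<in> A} = {1..card {j. (i, j) \<in> A}}" if "i \<in> fst ` A" for i
  proof -
    let ?R = "{j. (i, j) \<in> A}"
    have R: "finite ?R" "?R \<noteq> {}" using assms(1) that by (auto intro: finite_rows)
    have "?R = {1..Max ?R}"
    proof
      show "?R \<subseteq> {1..Max ?R}" using R assms(2) by (auto simp: board_def)
      show "{1..Max ?R} \<subseteq> ?R" using Max_in[OF R] lower by auto
    qed
    then show ?thesis by (metis card_atLeastAtMost diff_Suc_1 One_nat_def)
  qed
  then have "push_left A = Sigma (fst ` A) (\<lambda>i. {j. (i, j) \<in> A})"
    unfolding push_left_Sigma[OF assms(1,2)] by (intro Sigma_cong) auto
  then show ?thesis using Sigma_rows[of A] by simp
qed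

lemma push_up_eq_self:
  assumes "finite A" "A \<subseteq> board"
    and "\<And>i j i'. (i, j) \<in> A \<Longrightarrow> 1 \<le> i' \<Longrightarrow> i' \<le> i \<Longrightarrow> (i', j) \<in> A"
  shows "push_up A = A"
proof -
  have "push_left (prod.swap ` A) = prod.swap ` A"
    using assms by (intro push_left_eq_self) (auto simp: board_def pair_in_swap_image)
  then show ?thesis by (simp add: push_up_swap image_image)
qed

text \<open>The content of \<open>diag (m + 1)\<close> is left arbitrary, which makes the property
  invariant under every \<open>shift s\<close>.\<close>

definition staircase :: "nat \<Rightarrow> square set \<Rightarrow> bool" where
  "staircase m A \<longleftrightarrow> A \<subseteq> board \<and> (\<forall>k\<le>m. diag k \<subseteq> A) \<and> (\<forall>k>m + 1. A \<inter> diag k = {})"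

text \<open>A different square weakly above and to the left lies on a strictly earlier diagonal.
  Checkers reach at most \<open>diag (m + 1)\<close>, so that earlier diagonal is full.\<close>

lemma staircase_lower:
  assumes "staircase m A" "(i, j) \<in> A" "1 \<le> i'" "i' \<le> i" "1 \<le> j'" "j' \<le> j"
  shows "(i', j') \<in> A"
proof (cases "(i', j') = (i, j)")
  case False
  have "(i, j) \<in> diag (i + j - 1)" "(i', j') \<in> diag (i' + j' - 1)"
    using assms by (auto simp: diag_def)
  moreover from this assms(1,2) have "\<not> i + j - 1 > m + 1"
    unfolding staircase_def by blast
  then have "i' + j' - 1 \<le> m" using False assms by auto
  ultimately show ?thesis using assms(1) unfolding staircase_def by blast
qed (use assms in simp)

lemma shift_diag_image: "shift s ` diag k = diag k"
proof (rule endo_inj_surj[OF finite_diag])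
  show "shift s ` diag k \<subseteq> diag k" by (auto intro: shift_in_diag)
  show "inj_on (shift s) (diag k)"
    by (rule inj_on_subset[OF shift_inj]) (auto simp: diag_def board_def)
qed

lemma staircase_shift:
  assumes "staircase m A"
  shows "staircase m (shift s ` A)"
  unfolding staircase_def
proof (intro conjI allI impI)
  show "shift s ` A \<subseteq> board" using assms by (intro image_subsetI shift_board) (auto simp: staircase_def)
  show "diag k \<subseteq> shift s ` A" if "k \<le> m" for k
    using assms that image_mono[of "diag k" A "shift s"] by (simp add: staircase_def shift_diag_image)
  show "shift s ` A \<inter> diag k = {}" if "k > m + 1" for k
  proof (rule ccontr)
    assume "shift s ` A \<inter> diag k \<noteq> {}"
    then obtain x where x: "x \<in> A" "shift s x \<in> diag k" by blast
    then have "x \<in> board" using assms by (auto simp: staircase_def)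
    then obtain l where l: "x \<in> diag l" using board_diag by blast
    then have "l = k" using x(2) shift_in_diag diag_unique by blast
    then show False using assms that x(1) l by (auto simp: staircase_def)
  qed
qed

lemma ferrers_T_staircase:
  assumes "is_partition p n" "staircase m (ferrers p)"
  shows "ferrers (T s p) = shift s ` ferrers p"
proof -
  let ?A = "shift s ` ferrers p"
  have S: "staircase m ?A" using assms(2) by (rule staircase_shift)
  have A: "finite ?A" "?A \<subseteq> board"
    using ferrers_card[OF assms(1)] shift_board by auto
  have in_board: "1 \<le> i \<and> 1 \<le> j" if "(i, j) \<in> ?A" for i j
    using that A(2) by (auto simp: board_def)
  have "push_left ?A = ?A"
    using staircase_lower[OF S] in_board by (intro push_left_eq_self A) blast
  moreover have "push_up ?A = ?A"
    using staircase_lower[OF S] in_board by (intro push_up_eq_self A) blast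
  ultimately show ?thesis by (simp add: ferrers_T[OF assms(1)] T_arrangement_def)
qed

lemma ferrers_funpow_T_staircase:
  assumes "is_partition p n" "staircase m (ferrers p)"
  shows "ferrers ((T s ^^ t) p) = (shift s ^^ t) ` ferrers p \<and> staircase m (ferrers ((T s ^^ t) p))"
proof (induction t)
  case (Suc t)
  then have S: "staircase m (ferrers ((T s ^^ t) p))" by blast
  from S have "ferrers (T s ((T s ^^ t) p)) = shift s ` ferrers ((T s ^^ t) p)"
    by (rule ferrers_T_staircase[OF is_partition_funpow_T[OF assms(1)]])
  then show ?case using Suc staircase_shift[OF S, of s] by (simp add: image_image)
qed (use assms in simp)

text \<open>The graph determines the values at positive indices; the value at \<open>0\<close>,
  which it does not record, is fixed by \<open>is_partition\<close>.\<close>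

lemma ferrers_inject:
  assumes "is_partition p n" "is_partition q n" "ferrers p = ferrers q"
  shows "p = q"
proof
  fix i
  show "p i = q i"
  proof (cases "i = 0")
    case False
    have "{j. (i, j) \<in> ferrers p} = {j. (i, j) \<in> ferrers q}" using assms(3) by simp
    then have "{1..p i} = {1..q i}"
      using False by (simp add: ferrers_def atLeastAtMost_def atLeast_def atMost_def Int_def)
    then show ?thesis by (metis card_atLeastAtMost diff_Suc_1 One_nat_def)
  qed (use assms in \<open>simp add: is_partition_def\<close>)
qed

lemma periodic_if_staircase:
  assumes "is_partition p n" "staircase m (ferrers p)"
  shows "periodic_point (T s) p"
proof -
  \<comment> \<open>Every length \<open>k\<close> of an occupied diagonal is at most
    \<open>m + 1\<close> and so divides this factorial; \<open>N\<close> equal rotations of such a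
    diagonal are the identity.\<close>
  define N :: nat where "N = fact (m + 1)"
  have "(shift s ^^ N) x = x" if "x \<in> ferrers p" for x
  proof -
    have "x \<in> board" using that assms(2) by (auto simp: staircase_def)
    then obtain k where k: "x \<in> diag k" using board_diag by blast
    then obtain r where r: "r < k" "x = cell k r" by (auto simp: diag_eq_cell)
    have "k \<le> m + 1"
    proof (rule ccontr)
      assume "\<not> k \<le> m + 1"
      then have "ferrers p \<inter> diag k = {}" using assms(2) by (simp add: staircase_def)
      with k that show False by blast
    qed
    then have "k dvd N" using r(1) unfolding N_def by (intro dvd_fact) auto
    then obtain c where "N = k * c" by (rule dvdE)
    then show ?thesis using r by (simp add: funpow_shift_cell mult.assoc)
  qed
  then have "(shift s ^^ N) ` ferrers p = ferrers p" by simp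
  then have "ferrers ((T s ^^ N) p) = ferrers p"
    using ferrers_funpow_T_staircase[OF assms] by simp
  then have "(T s ^^ N) p = p"
    using ferrers_inject is_partition_funpow_T assms(1) by blast
  moreover have "N \<ge> 1" unfolding N_def by (rule fact_ge_1)
  ultimately show ?thesis unfolding periodic_point_def by blast
qed

lemma staircase_if_diag_cards:
  assumes "A \<subseteq> board" "finite A"
    and cards: "\<And>k. k \<ge> 1 \<Longrightarrow> k \<le> m \<Longrightarrow> card (A \<inter> diag k) = k"
      "\<And>k. k > m + 1 \<Longrightarrow> card (A \<inter> diag k) = 0"
  shows "staircase m A"
  unfolding staircase_def
proof (intro conjI allI impI assms(1))
  show "diag k \<subseteq> A" if "k \<le> m" for k
  proof (cases "k = 0")
    case False
    then have "A \<inter> diag k = diag k"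
      using cards(1) that by (intro card_subset_eq finite_diag) (auto simp: card_diag)
    then show ?thesis by blast
  qed (simp add: diag_eq_cell)
  show "A \<inter> diag k = {}" if "k > m + 1" for k
    using cards(2)[OF that] assms(2) by simp
qed

theorem theorem11:
  fixes n m :: nat and \<pi> :: "nat \<Rightarrow> nat" and s :: "nat \<Rightarrow> int"
  assumes "n > 0"
    and "is_partition \<pi> n"
    and "m * (m + 1) div 2 \<le> n" and "n < (m + 1) * (m + 2) div 2"
    and "\<forall>k\<ge>1. gcd (int k) (s k) = 1"
  shows "periodic_point (T s) \<pi> \<longleftrightarrow>
    (\<forall>k\<ge>1. card (ferrers \<pi> \<inter> diag k) =
      (if k \<le> m then k else if k = m + 1 then n - m * (m + 1) div 2 else 0))"
    (is "_ \<longleftrightarrow> ?cards")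
proof
  note F = ferrers_card[OF assms(2)]
  show ?cards if "periodic_point (T s) \<pi>"
    using diag_cards_if_full_or_next_empty[OF F(1,3,2) _ assms(3,4)]
      periodic_diag_full_or_next_empty[OF assms(2) that assms(5)] by blast
  assume cards: ?cards
  have "staircase m (ferrers \<pi>)"
    using cards by (intro staircase_if_diag_cards F) auto
  with assms(2) show "periodic_point (T s) \<pi>" by (rule periodic_if_staircase)
qed

end
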